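(* Let $(A_k)_{k\ge 1}$ be the sequence of positive real numbers described in the context. For each positive integer $k$, $$\#\{n \leq x : f(n) = k\} = A_k x + O_\varepsilon\left(x^{1/2+\varepsilon}\right)$$ for all real $x \geq 1$ and $\varepsilon > 0$, where the implied constant depends only on $\varepsilon$.
   Context: For a natural number $n > 1$ with prime factorization $n = p_1^{a_1}\cdots p_s^{a_s}$ ($p_1 < \cdots < p_s$ primes, $a_1,\dots,a_s$ positive integers), $f(n) := \#\{a_1,\dots,a_s\}$ is the number of distinct exponents; also $f(1) := 0$. In the counting set, $n$ runs over positive integers. $(A_k)_{k \geq 1}$ is the (unique) sequence of positive real numbers with the following property: for every real $a>1$ and every arithmetic function $\phi$ (complex-valued function on the positive integers, with the convention $\phi(0):=0$) satisfying $|\phi(k)| < a^k$ for all $k\ge 1$, the series $M_\phi := \sum_{k=1}^\infty A_k\phi(k)$ converges and $\sum_{n \leq x}\phi(f(n)) = M_\phi x + O_{a,\varepsilon}(x^{1/2+\varepsilon})$ for all $x \geq 1$ and $\varepsilon > 0$. (The existence of such a sequence is a separate theorem of the paper.) *)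

theory Defs
  imports Complex_Main "HOL-Computational_Algebra.Primes"
begin

definition distinct_exponents :: "nat \<Rightarrow> nat" where
  "distinct_exponents n = card ((\<lambda>p. multiplicity p n) ` prime_factors n)"

(* Arithmetic functions live on the positive integers; the value at 0 is the convention
   \<phi>(0) = 0, which matters because distinct_exponents 1 = 0. *)
definition growth_class :: "real \<Rightarrow> (nat \<Rightarrow> complex) set" where
  "growth_class a = {\<phi>. \<phi> 0 = 0 \<and> (\<forall>k\<ge>1. norm (\<phi> k) < a ^ k)}"

definition mean_value :: "(nat \<Rightarrow> real) \<Rightarrow> (nat \<Rightarrow> complex) \<Rightarrow> complex" where
  "mean_value A \<phi> = (\<Sum>k. of_real (A (Suc k)) * \<phi> (Suc k))"

(* The defining property of the sequence (A k), k \<ge> 1; the value A 0 plays no role.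
   The implied constant C may depend on a and \<epsilon>, but not on \<phi> or x. *)
definition mean_value_sequence :: "(nat \<Rightarrow> real) \<Rightarrow> bool" where
  "mean_value_sequence A \<longleftrightarrow>
     (\<forall>k\<ge>1. A k > 0) \<and>
     (\<forall>a>1. (\<forall>\<phi>\<in>growth_class a. summable (\<lambda>k. of_real (A (Suc k)) * \<phi> (Suc k))) \<and>
       (\<forall>\<epsilon>>0. \<exists>C::real. \<forall>\<phi>\<in>growth_class a. \<forall>x::real. x \<ge> 1 \<longrightarrow>
          norm ((\<Sum>n | 0 < n \<and> real n \<le> x. \<phi> (distinct_exponents n))
                  - mean_value A \<phi> * of_real x) \<le> C * x powr (1/2 + \<epsilon>)))"

end

theory Submission imports Defs begin

text \<open>
  The number of \<open>n \<le> x\<close> with exactly \<open>k\<close> distinct exponents is the summatory function of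
  \<open>\<phi> \<circ> distinct_exponents\<close> for \<open>\<phi>\<close> the indicator function of \<open>k\<close>, and the mean value of this
  \<open>\<phi>\<close> is the single term \<open>A k\<close>. So the claim is an instance of the property that defines \<open>A\<close>.
  The error term is uniform in \<open>k\<close> because all these indicators are bounded by 1 and hence lie
  in one and the same growth class, that of base 2, for every \<open>k \<ge> 1\<close>, and the
  constant attached to this class depends only on \<open>\<epsilon>\<close>.
\<close>

lemma indicator_in_growth_class:
  assumes "a > 1" "k \<ge> 1"
  shows "(\<lambda>j. of_bool (j = k)) \<in> growth_class a"
  using assms by (auto simp: growth_class_def of_bool_def intro: one_less_power)

lemma mean_value_indicator:
  assumes "k \<ge> 1"
  shows "mean_value A (\<lambda>j. of_bool (j = k)) = of_real (A k)"
proof -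
  have "mean_value A (\<lambda>j. of_bool (j = k))
      = (\<Sum>j\<in>{k - 1}. of_real (A (Suc j)) * of_bool (Suc j = k))"
    unfolding mean_value_def by (rule suminf_finite) auto
  then show ?thesis using assms by simp
qed

lemma sum_indicator_distinct_exponents:
  "(\<Sum>n | 0 < n \<and> real n \<le> x. of_bool (distinct_exponents n = k))
    = (of_nat (card {n. 0 < n \<and> real n \<le> x \<and> distinct_exponents n = k}) :: complex)"
proof -
  have "finite {n. 0 < n \<and> real n \<le> x}"
    by (rule finite_subset[of _ "{..nat \<lfloor>x\<rfloor>}"]) (auto simp: le_nat_floor)
  moreover have "{n. 0 < n \<and> real n \<le> x} \<inter> {n. distinct_exponents n = k}
      = {n. 0 < n \<and> real n \<le> x \<and> distinct_exponents n = k}"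
    by auto
  ultimately show ?thesis by (simp add: sum_of_bool_eq)
qed

theorem corollary1p1:
  fixes A :: "nat \<Rightarrow> real"
  assumes "mean_value_sequence A"
  shows "\<forall>\<epsilon>>0. \<exists>C::real. \<forall>k::nat. k \<ge> 1 \<longrightarrow> (\<forall>x::real. x \<ge> 1 \<longrightarrow>
    \<bar>real (card {n::nat. 0 < n \<and> real n \<le> x \<and> distinct_exponents n = k}) - A k * x\<bar>
      \<le> C * x powr (1/2 + \<epsilon>))"
proof (intro allI impI)
  fix \<epsilon> :: real
  assume "\<epsilon> > 0"
  moreover have "(2::real) > 1" by simp
  ultimately obtain C :: real where
    C: "\<And>\<phi> x. \<phi> \<in> growth_class 2 \<Longrightarrow> x \<ge> 1 \<Longrightarrow>
          norm ((\<Sum>n | 0 < n \<and> real n \<le> x. \<phi> (distinct_exponents n))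
                  - mean_value A \<phi> * of_real x) \<le> C * x powr (1/2 + \<epsilon>)"
    using assms unfolding mean_value_sequence_def by meson
  have "\<bar>real (card {n. 0 < n \<and> real n \<le> x \<and> distinct_exponents n = k}) - A k * x\<bar>
      \<le> C * x powr (1/2 + \<epsilon>)" if k: "k \<ge> 1" and x: "x \<ge> 1" for k x
  proof -
    let ?N = "card {n. 0 < n \<and> real n \<le> x \<and> distinct_exponents n = k}"
    have "norm (of_nat ?N - of_real (A k) * of_real x :: complex) \<le> C * x powr (1/2 + \<epsilon>)"
      using C[OF indicator_in_growth_class[OF _ k] x] k
      by (simp only: sum_indicator_distinct_exponents mean_value_indicator)
    moreover have "of_nat ?N - of_real (A k) * of_real x = (of_real (real ?N - A k * x) :: complex)"
      by simp
    ultimately show ?thesis by (simp only: norm_of_real)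
  qed
  then show "\<exists>C::real. \<forall>k::nat. k \<ge> 1 \<longrightarrow> (\<forall>x::real. x \<ge> 1 \<longrightarrow>
    \<bar>real (card {n::nat. 0 < n \<and> real n \<le> x \<and> distinct_exponents n = k}) - A k * x\<bar>
      \<le> C * x powr (1/2 + \<epsilon>))"
    by blast
qed

end
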